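(* Let $n,m$ be integers with $1\le m\le n$. Algorithm A (defined in the context), run on input $(n,m)$, returns $P(n,m)$. Moreover, the number of executions of the assignment $a_p\leftarrow a_p+a_{p-i}$ (that is, the number of steps excluding initialization) is exactly $$S_1(n,m)=\tfrac12\big(\min(m,n-m)-1\big)\big(2(n-m)-\min(m,n-m)\big).$$
   Context: $P(n,m)$ denotes the number of integer partitions of $n$ into exactly $m$ (positive) parts. Algorithm A, on input $(n,m)$: maintain an integer array $a_0,\dots,a_{n-m}$. (1) For $p=0,1,\dots,n-m$ set $a_p\leftarrow 1$. (2) For $i=2,3,\dots,\min(m,n-m)$ (in increasing order): for $p=i,i+1,\dots,n-m$ (in increasing order), set $a_p\leftarrow a_p+a_{p-i}$. (3) Return $a_{n-m}$. A loop whose upper bound is less than its lower bound is not executed. *)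

theory Defs
  imports Complex_Main "HOL-Library.Multiset"
begin

definition partitions_into :: "nat \<Rightarrow> nat \<Rightarrow> nat multiset set" where
  "partitions_into n m = {M. sum_mset M = n \<and> size M = m \<and> (\<forall>k \<in># M. 0 < k)}"

definition num_partitions :: "nat \<Rightarrow> nat \<Rightarrow> nat" where
  "num_partitions n m = card (partitions_into n m)"

definition for_loop :: "nat \<Rightarrow> nat \<Rightarrow> (nat \<Rightarrow> 's \<Rightarrow> 's) \<Rightarrow> 's \<Rightarrow> 's" where
  "for_loop lo hi body s = fold body [lo..<Suc hi] s"

text \<open>
  The state of the main part is the current array together with the number of
  executions of the assignment \<open>a_p \<leftarrow> a_p + a_(p-i)\<close> so far.
\<close>

type_synonym state = "int list \<times> nat"

definition add_step :: "nat \<Rightarrow> nat \<Rightarrow> state \<Rightarrow> state" where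
  "add_step i p = (\<lambda>(a, c). (a[p := a ! p + a ! (p - i)], Suc c))"

text \<open>
  The array is allocated with length \<open>n - m + 1\<close>; the allocated values (here 0) are
  all overwritten by the loop. Initialization is not counted.
\<close>

definition init_array :: "nat \<Rightarrow> nat \<Rightarrow> int list" where
  "init_array n m = for_loop 0 (n - m) (\<lambda>p a. a[p := 1]) (replicate (n - m + 1) 0)"

definition run_A :: "nat \<Rightarrow> nat \<Rightarrow> state" where
  "run_A n m =
     for_loop 2 (min m (n - m)) (\<lambda>i. for_loop i (n - m) (\<lambda>p. add_step i p)) (init_array n m, 0)"

definition result_A :: "nat \<Rightarrow> nat \<Rightarrow> int" where
  "result_A n m = fst (run_A n m) ! (n - m)"

definition num_steps_A :: "nat \<Rightarrow> nat \<Rightarrow> nat" where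
  "num_steps_A n m = snd (run_A n m)"

definition S1 :: "nat \<Rightarrow> nat \<Rightarrow> real" where
  "S1 n m = 1 / 2 * (real (min m (n - m)) - 1) * (2 * real (n - m) - real (min m (n - m)))"

end

(*
  Splitting a partition of p + i into exactly i parts according to whether it contains the part 1,
  and removing that 1 or else subtracting 1 from every part, gives
    P(p + i, i) = P(p + i - 1, i - 1) + P(p, i).
  With r i p = P(p + i, i) this reads r i p = r (i - 1) p + r i (p - i), which is the update of
  Algorithm A, so after round i the array holds r i.  For i > p the second summand vanishes, so
  r i p is constant in i >= p and the rounds beyond n - m can be skipped.
*)
theory Submission
  imports Defs
begin

lemma sum_mset_image_Suc: "sum_mset (image_mset Suc M) = sum_mset M + size M"
  by (induction M) auto

lemma size_le_sum_mset:
  fixes M :: "nat multiset"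
  assumes "\<forall>k \<in># M. 0 < k"
  shows "size M \<le> sum_mset M"
  using assms by (induction M) auto

text \<open>No part exceeds the sum \<open>n\<close>, so every such multiset comes from one of the
  finitely many lists of length \<open>m\<close> over \<open>{..n}\<close>. Finiteness is what lets
  \<open>card\<close> add up over the disjoint union later.\<close>

lemma finite_partitions_into: "finite (partitions_into n m)"
proof (rule finite_subset)
  show "partitions_into n m \<subseteq> mset ` {xs. set xs \<subseteq> {..n} \<and> length xs = m}"
  proof
    fix M assume M: "M \<in> partitions_into n m"
    obtain xs where xs: "M = mset xs" by (metis ex_mset)
    have "x \<le> n" if "x \<in> set xs" for x
      using M xs that by (auto simp: partitions_into_def sum_mset_sum_list member_le_sum_list)
    with M xs show "M \<in> mset ` {xs. set xs \<subseteq> {..n} \<and> length xs = m}"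
      by (auto simp: partitions_into_def)
  qed
qed (simp add: finite_lists_length_eq)

lemma partitions_into_rec:
  "partitions_into (p + Suc i) (Suc i) =
     add_mset 1 ` partitions_into (p + i) i \<union> image_mset Suc ` partitions_into p (Suc i)"
proof (intro equalityI subsetI)
  fix M assume M: "M \<in> partitions_into (p + Suc i) (Suc i)"
  show "M \<in> add_mset 1 ` partitions_into (p + i) i \<union> image_mset Suc ` partitions_into p (Suc i)"
  proof (cases "1 \<in># M")
    case True
    then obtain N where "M = add_mset 1 N" by (metis insert_DiffM)
    with M show ?thesis by (auto simp: partitions_into_def)
  next
    case False
    define N where "N = image_mset (\<lambda>k. k - 1) M"
    have ge: "2 \<le> k" if "k \<in># M" for k
      using M False that by (cases "k = 1") (auto simp: partitions_into_def Suc_le_eq)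
    \<comment> \<open>Natural subtraction truncates; the bound \<open>ge\<close> makes the
      predecessor map invertible here and also keeps the parts of \<open>N\<close> positive.\<close>
    have MN: "M = image_mset Suc N"
      unfolding N_def image_mset.compositionality
      using ge by (subst multiset.map_ident_strong) fastforce+
    have "N \<in> partitions_into p (Suc i)"
      using M ge unfolding partitions_into_def MN
      by (fastforce simp: sum_mset_image_Suc)
    with MN show ?thesis by blast
  qed
qed (auto simp: partitions_into_def sum_mset_image_Suc)

lemma num_partitions_rec:
  "num_partitions (p + Suc i) (Suc i) = num_partitions (p + i) i + num_partitions p (Suc i)"
proof -
  \<comment> \<open>The part 1 separates the two images: \<open>Suc\<close> turns positive parts
    into parts of size at least 2.\<close>
  have "add_mset 1 ` partitions_into (p + i) i \<inter> image_mset Suc ` partitions_into p (Suc i) = {}"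
  proof -
    have "1 \<notin># M" if "M \<in> image_mset Suc ` partitions_into p (Suc i)" for M
      using that by (auto simp: partitions_into_def)
    moreover have "1 \<in># M" if "M \<in> add_mset 1 ` partitions_into (p + i) i" for M
      using that by auto
    ultimately show ?thesis by blast
  qed
  moreover have "inj_on (add_mset 1) A" for A :: "nat multiset set"
    by (simp add: inj_on_def)
  moreover have "inj_on (image_mset Suc) A" for A
    by (rule inj_on_inverseI[where g = "image_mset (\<lambda>k. k - 1)"])
      (simp add: image_mset.compositionality comp_def)
  ultimately show ?thesis
    unfolding num_partitions_def partitions_into_rec
    by (simp add: card_Un_disjoint finite_partitions_into card_image)
qed

lemma num_partitions_eq_0:
  assumes "p < i"
  shows "num_partitions p i = 0"
proof -
  have "partitions_into p i = {}"
    using assms size_le_sum_mset leD unfolding partitions_into_def by blast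
  then show ?thesis by (simp add: num_partitions_def)
qed

text \<open>The term \<open>p - i + i\<close> stays unsimplified so that the equation has the shape
  of the hypothesis \<open>g\<close> of the inner loop lemma, with \<open>g q\<close> being
  \<open>num_partitions (q + i) i\<close>.\<close>

lemma num_partitions_add_rec:
  assumes "1 \<le> i"
  shows "num_partitions (p + i) i =
    num_partitions (p + (i - 1)) (i - 1) + (if p < i then 0 else num_partitions (p - i + i) i)"
  using num_partitions_rec[of p "i - 1"] assms by (simp add: num_partitions_eq_0)

lemma num_partitions_0_0: "num_partitions 0 0 = 1"
proof -
  have "partitions_into 0 0 = {{#}}" by (auto simp: partitions_into_def)
  then show ?thesis by (simp add: num_partitions_def)
qed

lemma num_partitions_pos_0: "0 < p \<Longrightarrow> num_partitions p 0 = 0"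
  by (auto simp: num_partitions_def partitions_into_def)

lemma num_partitions_1: "num_partitions (p + 1) 1 = 1"
proof (induction p)
  case 0
  then show ?case
    using num_partitions_rec[of 0 0] by (simp add: num_partitions_0_0 num_partitions_eq_0)
next
  case (Suc p)
  then show ?case
    using num_partitions_rec[of "Suc p" 0] by (simp add: num_partitions_pos_0)
qed

lemma num_partitions_add_stable:
  assumes "p \<le> i" "i \<le> j"
  shows "num_partitions (p + j) j = num_partitions (p + i) i"
  using assms(2)
proof (induction rule: dec_induct)
  case (step j)
  then show ?case using num_partitions_rec[of p j] assms(1) by (simp add: num_partitions_eq_0)
qed simp

lemma init_array_eq: "init_array n m = map (\<lambda>_. 1) [0..<Suc (n - m)]"
proof -
  \<comment> \<open>Invariant: the first \<open>k\<close> cells are initialized and the others still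
    hold the allocated 0.\<close>
  have "fold (\<lambda>p a. a[p := 1]) [0..<k] (replicate N 0)
      = map (\<lambda>q. if q < k then 1 else 0 :: int) [0..<N]" if "k \<le> N" for k N
    using that
    by (induction k) (auto intro!: nth_equalityI simp: nth_list_update less_Suc_eq)
  from this[OF order_refl] show ?thesis
    unfolding init_array_def for_loop_def by
      (simp del: upt_Suc replicate_Suc cong: map_cong)
qed

text \<open>One array suffices because \<open>p\<close> increases: when cell \<open>p\<close> is
  updated it still holds \<open>f p\<close>, while cell \<open>p - i\<close>, which lies strictly to
  the left, already holds \<open>g (p - i)\<close>. Cells below \<open>i\<close> are never written,
  and there \<open>g\<close> agrees with \<open>f\<close>.\<close>

lemma inner_loop:
  assumes "1 \<le> i" "i \<le> k" "k \<le> N"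
    and g: "\<And>q. g q = f q + (if q < i then 0 else g (q - i))"
  shows "fold (add_step i) [i..<k] (map f [0..<N], c) =
    (map (\<lambda>q. if q < k then g q else f q) [0..<N], c + (k - i))"
  using assms(2,3)
proof (induction rule: dec_induct)
  case base
  have "g q = f q" if "q < i" for q using g[of q] that by simp
  then show ?case by simp
next
  case (step k)
  have "(map (\<lambda>q. if q < k then g q else f q) [0..<N])[k := f k + g (k - i)]
      = map (\<lambda>q. if q < Suc k then g q else f q) [0..<N]"
    using step.hyps g[of k]
    by (intro nth_equalityI) (auto simp: nth_list_update less_Suc_eq)
  then show ?case using step assms(1) by (simp add: add_step_def Suc_diff_le)
qed

text \<open>Rounds start at 2, so for \<open>k\<close> equal to 0 or 1 none runs and the array is
  still the all-ones row of partitions into one part; hence \<open>max 1 k\<close>.\<close>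

lemma outer_loop:
  assumes "k \<le> d"
  shows "fold (\<lambda>i. fold (add_step i) [i..<Suc d]) [2..<Suc k] (map (\<lambda>_. 1) [0..<Suc d], 0) =
    (map (\<lambda>q. int (num_partitions (q + max 1 k) (max 1 k))) [0..<Suc d], \<Sum>i=2..k. Suc d - i)"
  using assms
proof (induction k)
  case 0
  show ?case by (auto simp: num_partitions_1[simplified])
next
  case (Suc k)
  show ?case
  proof (cases "k = 0")
    case True
    then show ?thesis by (auto simp: num_partitions_1[simplified])
  next
    case False
    let ?r = "\<lambda>i q. int (num_partitions (q + i) i)"
    have r: "?r (Suc k) q = ?r k q + (if q < Suc k then 0 else ?r (Suc k) (q - Suc k))" for q
      using num_partitions_add_rec[of "Suc k" q] by auto
    have "fold (add_step (Suc k)) [Suc k..<Suc d] (map (?r k) [0..<Suc d], c) =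
        (map (\<lambda>q. if q < Suc d then ?r (Suc k) q else ?r k q) [0..<Suc d], c + (Suc d - Suc k))" for c
      using Suc.prems by (intro inner_loop r) simp_all
    also have "map (\<lambda>q. if q < Suc d then ?r (Suc k) q else ?r k q) [0..<Suc d]
        = map (?r (Suc k)) [0..<Suc d]"
      by (rule map_cong) auto
    finally have inner: "fold (add_step (Suc k)) [Suc k..<Suc d] (map (?r k) [0..<Suc d], c) =
        (map (?r (Suc k)) [0..<Suc d], c + (Suc d - Suc k))" for c .
    have "max 1 k = k" "max 1 (Suc k) = Suc k" "[2..<Suc (Suc k)] = [2..<Suc k] @ [Suc k]"
      "(\<Sum>i=2..Suc k. Suc d - i) = (\<Sum>i=2..k. Suc d - i) + (Suc d - Suc k)"
      using False by (auto simp del: diff_Suc_Suc)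
    then show ?thesis
      using Suc inner by (simp only: fold_append fold.simps o_apply id_apply)
  qed
qed

text \<open>For \<open>k = 0\<close> the sum is empty but the closed form equals
  \<open>- real d\<close>, so that case forces \<open>d = 0\<close>. For \<open>k\<close> at least
  1, raising \<open>k\<close> by one increases both sides by \<open>d - k\<close>.\<close>

lemma real_sum_steps:
  assumes "k \<le> d" and "k = 0 \<Longrightarrow> d = 0"
  shows "real (\<Sum>i=2..k. Suc d - i) = 1 / 2 * (real k - 1) * (2 * real d - real k)"
proof (cases "k = 0")
  case False
  then have "1 \<le> k" by simp
  then show ?thesis using assms(1)
  proof (induction rule: dec_induct)
    case (step k)
    then have "(\<Sum>i=2..Suc k. Suc d - i) = (\<Sum>i=2..k. Suc d - i) + (d - k)" by simp
    then have "real (\<Sum>i=2..Suc k. Suc d - i) = real (\<Sum>i=2..k. Suc d - i) + (real d - real k)"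
      using step.prems by (simp only: of_nat_add of_nat_diff Suc_leD)
    also have "\<dots> = 1 / 2 * (real k - 1) * (2 * real d - real k) + (real d - real k)"
      using step.IH step.prems by (simp only: Suc_leD)
    finally show ?case by (simp only: of_nat_Suc) (simp add: field_simps)
  qed simp
qed (use assms in simp)

theorem mainTheorem2:
  fixes n m :: nat
  assumes "1 \<le> m" and "m \<le> n"
  shows "result_A n m = int (num_partitions n m) \<and> real (num_steps_A n m) = S1 n m"
proof
  define d k where "d = n - m" and "k = min m d"
  have kd: "k \<le> d" by (simp add: k_def)
  have run: "run_A n m = (map (\<lambda>q. int (num_partitions (q + max 1 k) (max 1 k))) [0..<Suc d],
      \<Sum>i=2..k. Suc d - i)"
    using outer_loop[OF kd]
    unfolding run_A_def init_array_eq for_loop_def d_def[symmetric] k_def[symmetric] .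
  \<comment> \<open>If \<open>m > d\<close> the rounds stop at \<open>d\<close>, and the entry at
    \<open>d\<close> has already reached its stable value. The maximum covers \<open>d = 0\<close>,
    where the one-part row is the final one.\<close>
  have "num_partitions (d + m) m = num_partitions (d + max 1 k) (max 1 k)"
  proof (cases "m \<le> d")
    case True
    then show ?thesis using assms by (simp add: k_def max_def)
  next
    case False
    then show ?thesis using assms by (intro num_partitions_add_stable) (auto simp: k_def)
  qed
  moreover have "d + m = n" using assms by (simp add: d_def)
  ultimately show "result_A n m = int (num_partitions n m)"
    unfolding result_A_def run d_def[symmetric] by (simp del: upt_Suc)
  show "real (num_steps_A n m) = S1 n m"
    using real_sum_steps[OF kd] assms
    unfolding num_steps_A_def run S1_def d_def[symmetric] k_def[symmetric]
    by (simp add: k_def)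
qed

end
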